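(* Let $n,m,\delta$ be integers with $\delta \geq n$ and $\delta \geq (m+1)/2$. If a hypergraph $\mathcal{H}$ with $n$ vertices, $m$ edges and minimum degree at least $\delta$ has no hamiltonian Berge cycle, then its incidence graph $I(\mathcal{H})$ is isomorphic either to $G_1(n)$ or to $G_2(a,b)$ for some positive integers $a \geq b$ with $a+b = n$ (graphs defined in the context, with parameter $\delta$).
   Context: A hypergraph $\mathcal{H}$ consists of a vertex set $V(\mathcal{H})$ and an edge set $E(\mathcal{H})$ whose elements are subsets of $V(\mathcal{H})$. The degree of a vertex is the number of edges containing it. A Berge cycle of length $\ell$ consists of $\ell$ distinct vertices $v_1,\dots,v_\ell$ and $\ell$ distinct edges $e_1,\dots,e_\ell$ with $v_i,v_{i+1}\in e_i$ (indices mod $\ell$); it is hamiltonian if $\{v_1,\dots,v_\ell\} = V(\mathcal{H})$. The incidence graph $I(\mathcal{H})$ is the bipartite graph with parts $X=V(\mathcal{H})$, $Y=E(\mathcal{H})$, with $v\in X$ adjacent to $e \in Y$ iff $v\in e$. $G_1(n)$ (when $\delta=n$): a copy of $K_{\delta,\delta-1}$ with parts $X$ of size $\delta$ and $Y_0$ of size $\delta-1$, where every vertex of $X$ receives an additional private neighbor of degree 1. $G_2(a,b)$: take a copy $H_1$ of $K_{a,\delta}$ and a copy $H_2$ of $K_{b,\delta}$ and identify one vertex of $H_1$ in its part of size $\delta$ with one vertex of $H_2$ in its part of size $\delta$; $X$ is the union of the parts of sizes $a$ and $b$. *)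

theory Defs
  imports Main
begin

text \<open>A hypergraph is given by a finite vertex set V, a finite set E of edge
  names and an incidence map inc assigning to each edge name its set of vertices.
  Edge names (rather than edges as plain sets) allow repeated edges, which the
  extremal graphs G1 and G2 require.\<close>

definition hypergraph :: "'v set \<Rightarrow> 'e set \<Rightarrow> ('e \<Rightarrow> 'v set) \<Rightarrow> bool" where
  "hypergraph V E inc \<longleftrightarrow> finite V \<and> finite E \<and> (\<forall>e\<in>E. inc e \<subseteq> V)"

definition hdegree :: "'e set \<Rightarrow> ('e \<Rightarrow> 'v set) \<Rightarrow> 'v \<Rightarrow> nat" where
  "hdegree E inc v = card {e\<in>E. v \<in> inc e}"

definition berge_cycle :: "'v set \<Rightarrow> 'e set \<Rightarrow> ('e \<Rightarrow> 'v set) \<Rightarrow> 'v list \<Rightarrow> 'e list \<Rightarrow> bool" where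
  "berge_cycle V E inc vs es \<longleftrightarrow>
     length vs = length es \<and> distinct vs \<and> distinct es \<and>
     set vs \<subseteq> V \<and> set es \<subseteq> E \<and>
     (\<forall>i < length vs. vs ! i \<in> inc (es ! i) \<and> vs ! ((i + 1) mod length vs) \<in> inc (es ! i))"

definition hamiltonian_berge_cycle :: "'v set \<Rightarrow> 'e set \<Rightarrow> ('e \<Rightarrow> 'v set) \<Rightarrow> 'v list \<Rightarrow> 'e list \<Rightarrow> bool" where
  "hamiltonian_berge_cycle V E inc vs es \<longleftrightarrow> berge_cycle V E inc vs es \<and> set vs = V"

definition graph_iso :: "'a set \<Rightarrow> ('a \<Rightarrow> 'a \<Rightarrow> bool) \<Rightarrow> 'b set \<Rightarrow> ('b \<Rightarrow> 'b \<Rightarrow> bool) \<Rightarrow> bool" where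
  "graph_iso W1 A1 W2 A2 \<longleftrightarrow>
     (\<exists>f. bij_betw f W1 W2 \<and> (\<forall>x\<in>W1. \<forall>y\<in>W1. A1 x y \<longleftrightarrow> A2 (f x) (f y)))"

definition inc_verts :: "'v set \<Rightarrow> 'e set \<Rightarrow> ('v + 'e) set" where
  "inc_verts V E = Inl ` V \<union> Inr ` E"

fun inc_adj :: "('e \<Rightarrow> 'v set) \<Rightarrow> ('v + 'e) \<Rightarrow> ('v + 'e) \<Rightarrow> bool" where
  "inc_adj inc (Inl v) (Inr e) = (v \<in> inc e)"
| "inc_adj inc (Inr e) (Inl v) = (v \<in> inc e)"
| "inc_adj inc _ _ = False"

text \<open>G1(n) with delta = n: X = {(0,i) | i<n}, Y0 = {(1,j) | j<n-1},
  private neighbours (2,i), i<n, with (2,i) adjacent only to (0,i).\<close>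

definition G1_verts :: "nat \<Rightarrow> (nat \<times> nat) set" where
  "G1_verts n = {(0,i) | i. i < n} \<union> {(1,j) | j. j < n - 1} \<union> {(2,i) | i. i < n}"

definition G1_adj0 :: "nat \<times> nat \<Rightarrow> nat \<times> nat \<Rightarrow> bool" where
  "G1_adj0 p q \<longleftrightarrow> fst p = 0 \<and> (fst q = 1 \<or> (fst q = 2 \<and> snd q = snd p))"

definition G1_adj :: "nat \<times> nat \<Rightarrow> nat \<times> nat \<Rightarrow> bool" where
  "G1_adj p q \<longleftrightarrow> G1_adj0 p q \<or> G1_adj0 q p"

text \<open>G2(a,b) with parameter delta: A = {(0,i) | i<a}, B = {(1,i) | i<b},
  C1 = {(2,j) | j<delta-1}, C2 = {(3,j) | j<delta-1}, shared vertex (4,0).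
  H1 = K_{a,delta} on A and C1 + shared; H2 = K_{b,delta} on B and C2 + shared.\<close>

definition G2_verts :: "nat \<Rightarrow> nat \<Rightarrow> nat \<Rightarrow> (nat \<times> nat) set" where
  "G2_verts \<delta> a b = {(0,i) | i. i < a} \<union> {(1,i) | i. i < b} \<union>
     {(2,j) | j. j < \<delta> - 1} \<union> {(3,j) | j. j < \<delta> - 1} \<union> {(4,0)}"

definition G2_adj0 :: "nat \<times> nat \<Rightarrow> nat \<times> nat \<Rightarrow> bool" where
  "G2_adj0 p q \<longleftrightarrow> (fst p = 0 \<and> (fst q = 2 \<or> fst q = 4)) \<or> (fst p = 1 \<and> (fst q = 3 \<or> fst q = 4))"

definition G2_adj :: "nat \<times> nat \<Rightarrow> nat \<times> nat \<Rightarrow> bool" where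
  "G2_adj p q \<longleftrightarrow> G2_adj0 p q \<or> G2_adj0 q p"

end

theory Submission
  imports Defs
begin

text \<open>Induction on the number of vertices. After removing a vertex u, the remaining n - 1 vertices
  either form a G2 configuration, which u can only enlarge, or lie on a Berge cycle
  x 0, y 0, x 1, y 1, ... of length l = n - 1. In the latter case the edges of the cycle are chosen
  so that as few of them as possible contain u; let d be their number. If u lies on y i and y j,
  rerouting the cycle through u shows that x i and x j have no common edge off the cycle, nor one
  with u, and the same holds for their successors. Counting the edges off the cycle then leaves
  three cases: d = 0, which gives G2; d = l with \<delta> = n, which gives G1; and 2 \<le> d < l with
  \<delta> = n, where the two cycle vertices next to each y i containing u lie on every edge of the cycle, and a
  rotation at a place where y i contains u but its successor does not closes a hamiltonian cycle.\<close>

section \<open>Berge paths\<close>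

text \<open>Only the vertex set \<open>A\<close> and the edge set \<open>F\<close> are recorded, so
  joining paths becomes a matter of disjoint sets; the order is recovered in
  \<open>berge_path_lists\<close>.\<close>

inductive berge_path :: "('e \<Rightarrow> 'v set) \<Rightarrow> 'v \<Rightarrow> 'v \<Rightarrow> 'v set \<Rightarrow> 'e set \<Rightarrow> bool"
  for inc where
  single: "berge_path inc u u {u} {}"
| extend: "\<lbrakk>berge_path inc u v A F; v \<in> inc e; w \<in> inc e; w \<notin> A; e \<notin> F\<rbrakk>
    \<Longrightarrow> berge_path inc u w (insert w A) (insert e F)"

lemma berge_path_ends: "berge_path inc u v A F \<Longrightarrow> u \<in> A \<and> v \<in> A"
  by (induction rule: berge_path.induct) auto

text \<open>The path traversed second stands as the first premise because the induction runs over
  it, appending its steps one by one.\<close>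

lemma berge_path_join:
  assumes "berge_path inc u' v' A' F'" and "berge_path inc u v A F"
    and "v \<in> inc e" "u' \<in> inc e" "A \<inter> A' = {}" "F \<inter> F' = {}" "e \<notin> F" "e \<notin> F'"
  shows "berge_path inc u v' (A \<union> A') (insert e (F \<union> F'))"
  using assms
proof (induction rule: berge_path.induct)
  case (single u')
  then show ?case using berge_path.extend[of inc u v A F e u'] by auto
next
  case (extend u' v' A' F' e' w)
  have "berge_path inc u v' (A \<union> A') (insert e (F \<union> F'))"
    using extend by auto
  then have "berge_path inc u w (insert w (A \<union> A')) (insert e' (insert e (F \<union> F')))"
    by (rule berge_path.extend) (use extend in auto)
  then show ?case by (simp add: insert_commute)
qed

lemma berge_path_rev: "berge_path inc u v A F \<Longrightarrow> berge_path inc v u A F"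
proof (induction rule: berge_path.induct)
  case (single u)
  show ?case by (rule berge_path.single)
next
  case (extend u v A F e w)
  \<comment> \<open>The new end \<open>w\<close> is a path of one vertex, and the reversed path is
    appended to it through \<open>e\<close>.\<close>
  have "berge_path inc w u ({w} \<union> A) (insert e ({} \<union> F))"
    by (rule berge_path_join[OF extend.IH berge_path.single]) (use extend in auto)
  then show ?case by simp
qed

lemma berge_path_lists:
  assumes "berge_path inc u v A F"
  shows "\<exists>vs es. length vs = Suc (length es) \<and> distinct vs \<and> distinct es \<and> set vs = A \<and>
    set es = F \<and> vs ! 0 = u \<and> vs ! length es = v \<and>
    (\<forall>i<length es. vs ! i \<in> inc (es ! i) \<and> vs ! Suc i \<in> inc (es ! i))"
  using assms
proof (induction rule: berge_path.induct)
  case (single u)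
  show ?case by (rule exI[of _ "[u]"], rule exI[of _ "[]"]) simp
next
  case (extend u v A F e w)
  then obtain vs es where *: "length vs = Suc (length es)" "distinct vs" "distinct es"
    "set vs = A" "set es = F" "vs ! 0 = u" "vs ! length es = v"
    "\<forall>i<length es. vs ! i \<in> inc (es ! i) \<and> vs ! Suc i \<in> inc (es ! i)"
    by blast
  show ?case
    by (rule exI[of _ "vs @ [w]"], rule exI[of _ "es @ [e]"])
      (use * extend in \<open>auto simp: nth_append less_Suc_eq\<close>)
qed

text \<open>A hamiltonian Berge cycle cut open at one edge \<open>e\<close>. For
  \<open>u = v\<close> and \<open>F = {}\<close> it is a cycle of length one; the empty cycle of the
  list encoding is excluded.\<close>

definition berge_hamiltonian :: "('e \<Rightarrow> 'v set) \<Rightarrow> 'v set \<Rightarrow> 'e set \<Rightarrow> bool" where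
  "berge_hamiltonian inc V E \<longleftrightarrow>
    (\<exists>u v F e. berge_path inc u v V F \<and> insert e F \<subseteq> E \<and> e \<notin> F \<and> u \<in> inc e \<and> v \<in> inc e)"

lemma berge_hamiltonianI:
  assumes "berge_path inc u v V F" "F \<subseteq> E" "e \<in> E" "e \<notin> F" "u \<in> inc e" "v \<in> inc e"
  shows "berge_hamiltonian inc V E"
  using assms unfolding berge_hamiltonian_def by blast

lemma berge_hamiltonian_cycle:
  assumes "berge_hamiltonian inc V E"
  shows "\<exists>vs es. hamiltonian_berge_cycle V E inc vs es"
proof -
  obtain u v F e where *: "berge_path inc u v V F" "insert e F \<subseteq> E" "e \<notin> F"
    "u \<in> inc e" "v \<in> inc e"
    using assms unfolding berge_hamiltonian_def by blast
  obtain vs es where L: "length vs = Suc (length es)" "distinct vs" "distinct es"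
    "set vs = V" "set es = F" "vs ! 0 = u" "vs ! length es = v"
    "\<forall>i<length es. vs ! i \<in> inc (es ! i) \<and> vs ! Suc i \<in> inc (es ! i)"
    using berge_path_lists[OF *(1)] by blast
  have "hamiltonian_berge_cycle V E inc vs (es @ [e])"
    unfolding hamiltonian_berge_cycle_def berge_cycle_def
    using L * by (auto simp: nth_append less_Suc_eq mod_Suc)
  then show ?thesis by blast
qed

text \<open>Vertices and edges can be taken in any order here, so only their numbers matter. This
  supplies the paths through the two sides of a G2 configuration.\<close>

lemma berge_path_complete:
  assumes "finite A" "A \<noteq> {}" "finite C" "card A \<le> Suc (card C)" "\<And>c. c \<in> C \<Longrightarrow> A \<subseteq> inc c"
  shows "\<exists>u v F. F \<subseteq> C \<and> berge_path inc u v A F"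
  using assms
proof (induction A arbitrary: C rule: finite_ne_induct)
  case (singleton a)
  show ?case using berge_path.single[of inc a] by (intro exI[of _ a] exI[of _ "{}"]) simp
next
  case (insert a A)
  have "0 < card A" using insert by (simp add: card_gt_0_iff)
  then have "C \<noteq> {}" using insert by auto
  then obtain c where c: "c \<in> C" by blast
  have "Suc (card (C - {c})) = card C"
    using c insert.prems by (metis card.remove)
  then obtain u v F where *: "F \<subseteq> C - {c}" "berge_path inc u v A F"
    using insert.IH[of "C - {c}"] insert.prems insert.hyps by (auto simp: card_insert_if)
  have "berge_path inc u a (insert a A) (insert c F)"
  proof (rule berge_path.extend[OF *(2)])
    show "v \<in> inc c" "a \<in> inc c"
      using berge_path_ends[OF *(2)] insert.prems(3)[OF c] by blast+
  qed (use * insert.hyps in blast)+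
  then show ?case using * c by blast
qed

section \<open>Berge cycles as periodic sequences\<close>

lemma window_representative:
  fixes l :: nat
  assumes "0 < l"
  shows "\<exists>k. a \<le> k \<and> k < a + l \<and> k mod l = i mod l"
proof (intro exI conjI)
  \<comment> \<open>Adding \<open>l * a\<close>, a multiple of \<open>l\<close> that is at least
    \<open>a\<close>, makes the subtraction of \<open>a\<close> exact.\<close>
  let ?k = "a + (i + l * a - a) mod l"
  show "a \<le> ?k" "?k < a + l" using assms by auto
  have "a \<le> l * a" using assms by (cases l) simp_all
  then have "a + (i + l * a - a) = i + l * a" by linarith
  then show "?k mod l = i mod l" by (metis mod_add_right_eq mod_mult_self2)
qed

lemma window_mod_eq:
  fixes l :: nat
  assumes "i mod l = j mod l" "i \<le> j" "j < i + l"
  shows "i = j"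
proof -
  have "l dvd j - i" using assms by (metis mod_eq_dvd_iff_nat)
  then show ?thesis using assms by (metis add.commute dvd_imp_le le_neq_implies_less less_diff_conv2 not_less zero_less_diff)
qed

text \<open>Indexing by all natural numbers lets a walk run past \<open>l\<close> without reducing
  indices. \<open>x_eq\<close> and \<open>y_eq\<close> express periodicity and distinctness at
  once.\<close>

locale periodic_cycle =
  fixes inc :: "'e \<Rightarrow> 'v set" and x :: "nat \<Rightarrow> 'v" and y :: "nat \<Rightarrow> 'e" and l :: nat
  assumes l_pos: "0 < l"
    and x_eq: "\<And>i j. x i = x j \<longleftrightarrow> i mod l = j mod l"
    and y_eq: "\<And>i j. y i = y j \<longleftrightarrow> i mod l = j mod l"
    and x_inc: "\<And>i. x i \<in> inc (y i)"
    and x_Suc_inc: "\<And>i. x (Suc i) \<in> inc (y i)"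
begin

lemma x_period: "x (i + l) = x i" and y_period: "y (i + l) = y i"
  by (simp_all add: x_eq y_eq)

lemma x_window_inj: "i \<le> j \<Longrightarrow> j < i + l \<Longrightarrow> x i = x j \<longleftrightarrow> i = j"
  and y_window_inj: "i \<le> j \<Longrightarrow> j < i + l \<Longrightarrow> y i = y j \<longleftrightarrow> i = j"
  unfolding x_eq y_eq using window_mod_eq by blast+

lemma x_window: "x ` {a..<a + l} = range x" and y_window: "y ` {a..<a + l} = range y"
proof -
  have "x i \<in> x ` {a..<a + l} \<and> y i \<in> y ` {a..<a + l}" for i
  proof -
    obtain k where "a \<le> k" "k < a + l" "k mod l = i mod l"
      using window_representative[OF l_pos] by blast
    then have "x i = x k" "y i = y k" "k \<in> {a..<a + l}" by (simp_all add: x_eq y_eq)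
    then show ?thesis by blast
  qed
  then show "x ` {a..<a + l} = range x" "y ` {a..<a + l} = range y"
    by blast+
qed

lemma card_range_x: "card (range x) = l" and card_range_y: "card (range y) = l"
  and finite_range_x: "finite (range x)" and finite_range_y: "finite (range y)"
proof -
  have "inj_on x {0..<0 + l}" "inj_on y {0..<0 + l}" by (auto simp: inj_on_def x_eq y_eq)
  then show "card (range x) = l" "card (range y) = l"
    unfolding x_window[of 0, symmetric] y_window[of 0, symmetric] by (simp_all add: card_image)
  show "finite (range x)" "finite (range y)"
    unfolding x_window[of 0, symmetric] y_window[of 0, symmetric] by simp_all
qed

lemma y_notin: "c < a \<Longrightarrow> b \<le> c + l \<Longrightarrow> y c \<notin> y ` {a..<b}"
  "b \<le> c \<Longrightarrow> c < a + l \<Longrightarrow> y c \<notin> y ` {a..<b}"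
proof -
  show "y c \<notin> y ` {a..<b}" if "c < a" "b \<le> c + l"
  proof
    assume "y c \<in> y ` {a..<b}"
    then obtain k where "y c = y k" "a \<le> k" "k < b" by auto
    then show False using that y_window_inj[of c k] by simp
  qed
  show "y c \<notin> y ` {a..<b}" if "b \<le> c" "c < a + l"
  proof
    assume "y c \<in> y ` {a..<b}"
    then obtain k where "y k = y c" "a \<le> k" "k < b" by auto
    then show False using that y_window_inj[of k c] by simp
  qed
qed

lemma x_disjoint:
  assumes "b < c" "d < a + l"
  shows "x ` {a..b} \<inter> x ` {c..d} = {}"
proof -
  have "x i \<noteq> x j" if "i \<in> {a..b}" "j \<in> {c..d}" for i j
    using x_window_inj[of i j] that assms by simp
  then show ?thesis by blast
qed

lemma y_disjoint:
  assumes "b \<le> c" "d \<le> a + l"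
  shows "y ` {a..<b} \<inter> y ` {c..<d} = {}"
proof -
  have "y i \<noteq> y j" if "i \<in> {a..<b}" "j \<in> {c..<d}" for i j
    using y_window_inj[of i j] that assms by simp
  then show ?thesis by blast
qed

lemma segment:
  assumes "a \<le> b" "b < a + l"
  shows "berge_path inc (x a) (x b) (x ` {a..b}) (y ` {a..<b})"
  using assms
proof (induction b rule: dec_induct)
  case base
  show ?case using berge_path.single by simp
next
  case (step b)
  have "berge_path inc (x a) (x (Suc b)) (insert (x (Suc b)) (x ` {a..b})) (insert (y b) (y ` {a..<b}))"
  proof (rule berge_path.extend)
    show "berge_path inc (x a) (x b) (x ` {a..b}) (y ` {a..<b})" using step by simp
    show "x (Suc b) \<notin> x ` {a..b}"
      using x_disjoint[of b "Suc b" "Suc b" a] step by auto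
    show "y b \<notin> y ` {a..<b}" using y_notin step by simp
  qed (rule x_inc x_Suc_inc)+
  then show ?case using step by (simp add: atLeastAtMostSuc_conv atLeastLessThanSuc)
qed

text \<open>The segment from \<open>Suc i\<close> to \<open>i + l\<close> goes once around the
  cycle, since \<open>x (i + l) = x i\<close>; only \<open>y i\<close> is left out.\<close>

lemma segment_cut:
  "berge_path inc (x (Suc i)) (x i) (range x) (y ` {Suc i..<i + l})"
proof -
  have "{Suc i..i + l} = {Suc i..<Suc i + l}" by auto
  then show ?thesis
    using segment[of "Suc i" "i + l"] x_window[of "Suc i"] l_pos by (simp add: x_period)
qed

section \<open>Exchanging edges of a cycle while keeping its vertices\<close>

lemma update_edge:
  assumes "w \<notin> range y" "x i \<in> inc w" "x (Suc i) \<in> inc w"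
  shows "periodic_cycle inc x (\<lambda>k. if k mod l = i mod l then w else y k) l"
proof
  have neq: "w \<noteq> y k" "y k \<noteq> w" for k using assms(1) by auto
  fix k j
  show "(if k mod l = i mod l then w else y k) = (if j mod l = i mod l then w else y j)
      \<longleftrightarrow> k mod l = j mod l"
    using neq by (simp add: y_eq)
  have "k mod l = i mod l \<Longrightarrow> x k = x i" "k mod l = i mod l \<Longrightarrow> x (Suc k) = x (Suc i)"
    unfolding x_eq by (assumption, metis mod_Suc_eq)
  then show "x k \<in> inc (if k mod l = i mod l then w else y k)"
    and "x (Suc k) \<in> inc (if k mod l = i mod l then w else y k)"
    using assms x_inc[of k] x_Suc_inc[of k] by simp_all
qed (simp_all add: l_pos x_eq)

text \<open>This serves to move a cycle edge containing \<open>u\<close> to a position that a later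
  rerouting leaves free.\<close>

lemma swap_edges:
  assumes "x i \<in> inc (y j)" "x (Suc i) \<in> inc (y j)" "x j \<in> inc (y i)" "x (Suc j) \<in> inc (y i)"
  shows "periodic_cycle inc x
    (\<lambda>k. if k mod l = i mod l then y j else if k mod l = j mod l then y i else y k) l"
    (is "periodic_cycle inc x ?y l")
proof
  fix k k'
  show "?y k = ?y k' \<longleftrightarrow> k mod l = k' mod l"
    by (simp add: y_eq)
  have "k mod l = h mod l \<Longrightarrow> x k = x h" "k mod l = h mod l \<Longrightarrow> x (Suc k) = x (Suc h)" for h
    unfolding x_eq by (assumption, metis mod_Suc_eq)
  from this[of i] this[of j]
  show "x k \<in> inc (?y k)" and "x (Suc k) \<in> inc (?y k)"
    using assms x_inc[of k] x_Suc_inc[of k] by simp_all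
qed (simp_all add: l_pos x_eq)

end

lemma hamiltonian_periodic_cycle:
  assumes "berge_hamiltonian inc V E"
  shows "\<exists>x y. periodic_cycle inc x y (card V) \<and> range x = V \<and> range y \<subseteq> E"
proof -
  obtain vs es where "hamiltonian_berge_cycle V E inc vs es"
    using berge_hamiltonian_cycle[OF assms] by blast
  then have *: "length vs = length es" "distinct vs" "distinct es" "set vs = V" "set es \<subseteq> E"
    and i1: "\<And>i. i < length vs \<Longrightarrow> vs ! i \<in> inc (es ! i)"
    and i2: "\<And>i. i < length vs \<Longrightarrow> vs ! ((i + 1) mod length vs) \<in> inc (es ! i)"
    unfolding hamiltonian_berge_cycle_def berge_cycle_def by auto
  let ?l = "length vs"
  have "V \<noteq> {}" using assms berge_path_ends unfolding berge_hamiltonian_def by fast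
  then have pos: "0 < ?l" using * by auto
  have card: "card V = ?l" using * distinct_card by force
  let ?x = "\<lambda>i. vs ! (i mod ?l)" and ?y = "\<lambda>i. es ! (i mod ?l)"
  have "periodic_cycle inc ?x ?y ?l"
  proof
    fix i j
    show "?x i = ?x j \<longleftrightarrow> i mod ?l = j mod ?l" using * pos nth_eq_iff_index_eq[of vs] by simp
    show "?y i = ?y j \<longleftrightarrow> i mod ?l = j mod ?l" using * pos nth_eq_iff_index_eq[of es] by simp
    show "?x i \<in> inc (?y i)" using i1 pos by simp
    show "?x (Suc i) \<in> inc (?y i)" using i2[of "i mod ?l"] pos by (simp add: mod_Suc_eq)
  qed (rule pos)
  moreover have "range ?x = V"
  proof
    show "range ?x \<subseteq> V" using * pos by auto
    show "V \<subseteq> range ?x"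
    proof
      fix v assume "v \<in> V"
      then obtain i where "i < ?l" "vs ! i = v" using * by (metis in_set_conv_nth)
      then have "v = ?x i" by simp
      then show "v \<in> range ?x" by blast
    qed
  qed
  moreover have "range ?y \<subseteq> E" using * pos by (auto simp: subset_iff)
  ultimately show ?thesis unfolding card by blast
qed

section \<open>Inserting a further vertex into a cycle\<close>

locale extra_vertex = periodic_cycle inc x y l
  for inc :: "'e \<Rightarrow> 'v set" and x y l +
  fixes u :: 'v and E :: "'e set"
  assumes u_notin: "u \<notin> range x" and y_E: "range y \<subseteq> E"
begin

lemma y_in_E: "y i \<in> E"
  using y_E by blast

text \<open>The vertex \<open>u\<close> takes the place of \<open>y i\<close> between its two ends.
  The excluded edges do not include \<open>y i\<close>, so \<open>e\<close> or \<open>f\<close> may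
  be \<open>y i\<close> itself.\<close>

lemma insert_between:
  assumes "e \<in> E" "f \<in> E" "e \<noteq> f" "e \<notin> y ` {Suc i..<i + l}" "f \<notin> y ` {Suc i..<i + l}"
    and "x i \<in> inc e" "x (Suc i) \<in> inc f" "u \<in> inc e" "u \<in> inc f"
  shows "berge_hamiltonian inc (insert u (range x)) E"
proof (rule berge_hamiltonianI[where e = f])
  show "berge_path inc (x (Suc i)) u (insert u (range x)) (insert e (y ` {Suc i..<i + l}))"
    by (rule berge_path.extend[OF segment_cut]) (use assms u_notin in auto)
qed (use assms y_E in auto)

section \<open>Reroutings that cut the cycle at two of its edges\<close>

lemma segments_cover:
  assumes "i < j" "j < i + l"
  shows "x ` {Suc i..j} \<union> x ` {Suc j..i + l} = range x"
    and "x ` {Suc i..j} \<inter> x ` {Suc j..i + l} = {}"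
    and "y ` {Suc i..<j} \<inter> y ` {Suc j..<i + l} = {}"
    and "y i \<notin> y ` {Suc i..<j}" "y i \<notin> y ` {Suc j..<i + l}"
    and "y j \<notin> y ` {Suc i..<j}" "y j \<notin> y ` {Suc j..<i + l}" "y i \<noteq> y j"
proof -
  have "{Suc i..j} \<union> {Suc j..i + l} = {Suc i..<Suc i + l}" using assms by auto
  then show "x ` {Suc i..j} \<union> x ` {Suc j..i + l} = range x"
    by (metis image_Un x_window)
  show "y i \<noteq> y j" using y_window_inj[of i j] assms by simp
qed (use assms in \<open>simp_all add: x_disjoint y_disjoint y_notin del: UN_simps\<close>)

lemma segment_ends:
  assumes "i < j" "j < i + l"
  shows "berge_path inc (x (Suc i)) (x j) (x ` {Suc i..j}) (y ` {Suc i..<j})"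
    and "berge_path inc (x (Suc j)) (x i) (x ` {Suc j..i + l}) (y ` {Suc j..<i + l})"
proof -
  show "berge_path inc (x (Suc i)) (x j) (x ` {Suc i..j}) (y ` {Suc i..<j})"
    by (rule segment) (use assms in simp_all)
  have "berge_path inc (x (Suc j)) (x (i + l)) (x ` {Suc j..i + l}) (y ` {Suc j..<i + l})"
    by (rule segment) (use assms in simp_all)
  then show "berge_path inc (x (Suc j)) (x i) (x ` {Suc j..i + l}) (y ` {Suc j..<i + l})"
    by (simp only: x_period)
qed

text \<open>The cycle is u, y i, x i, backwards to x (j + 1), w, x (i + 1), forwards to x j, y j,
  u.\<close>

lemma crossing_right:
  assumes ij: "i < j" "j < i + l" and w: "w \<in> E" "w \<notin> range y"
    and u: "u \<in> inc (y i)" "u \<in> inc (y j)" and x: "x (Suc i) \<in> inc w" "x (Suc j) \<in> inc w"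
  shows "berge_hamiltonian inc (insert u (range x)) E"
proof -
  note S = segments_cover[OF ij]
  let ?F = "insert w (y ` {Suc j..<i + l} \<union> y ` {Suc i..<j})"
  have wy: "w \<notin> y ` {Suc i..<j}" "w \<notin> y ` {Suc j..<i + l}" "y h \<noteq> w" for h
    using w(2) by auto
  have "berge_path inc (x i) (x j) (x ` {Suc j..i + l} \<union> x ` {Suc i..j}) ?F"
    by (rule berge_path_join[OF segment_ends(1)[OF ij] berge_path_rev[OF segment_ends(2)[OF ij]]])
      (simp_all only: Int_commute[of "x ` {Suc j..i + l}"] Int_commute[of "y ` {Suc j..<i + l}"]
        S wy x not_False_eq_True)
  then have P: "berge_path inc (x i) (x j) (range x) ?F"
    using S(1) by (simp only: Un_commute)
  show ?thesis
  proof (rule berge_hamiltonianI[where e = "y i"])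
    show "berge_path inc (x i) u (insert u (range x)) (insert (y j) ?F)"
      by (rule berge_path.extend[OF P x_inc]) (use u u_notin wy S(4-8) in simp_all)
    show "y i \<notin> insert (y j) ?F"
      using wy S(4-8) by simp
    show "insert (y j) ?F \<subseteq> E" using y_E w(1) by blast
  qed (rule y_in_E u x_inc x_Suc_inc)+
qed

text \<open>The cycle is u, y j, x (j + 1), forwards to x i, w, x j, backwards to x (i + 1), y i,
  u.\<close>

lemma crossing_left:
  assumes ij: "i < j" "j < i + l" and w: "w \<in> E" "w \<notin> range y"
    and u: "u \<in> inc (y i)" "u \<in> inc (y j)" and x: "x i \<in> inc w" "x j \<in> inc w"
  shows "berge_hamiltonian inc (insert u (range x)) E"
proof -
  note S = segments_cover[OF ij]
  let ?F = "insert w (y ` {Suc j..<i + l} \<union> y ` {Suc i..<j})"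
  have wy: "w \<notin> y ` {Suc i..<j}" "w \<notin> y ` {Suc j..<i + l}" "y h \<noteq> w" for h
    using w(2) by auto
  have "berge_path inc (x (Suc j)) (x (Suc i)) (x ` {Suc j..i + l} \<union> x ` {Suc i..j}) ?F"
    by (rule berge_path_join[OF berge_path_rev[OF segment_ends(1)[OF ij]] segment_ends(2)[OF ij]])
      (simp_all only: Int_commute[of "x ` {Suc j..i + l}"] Int_commute[of "y ` {Suc j..<i + l}"]
        S wy x not_False_eq_True)
  then have P: "berge_path inc (x (Suc j)) (x (Suc i)) (range x) ?F"
    using S(1) by (simp only: Un_commute)
  show ?thesis
  proof (rule berge_hamiltonianI[where e = "y j"])
    show "berge_path inc (x (Suc j)) u (insert u (range x)) (insert (y i) ?F)"
      by (rule berge_path.extend[OF P x_Suc_inc]) (use u u_notin wy S(4-8) in simp_all)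
    show "y j \<notin> insert (y i) ?F"
      using wy S(4-8) by simp
    show "insert (y i) ?F \<subseteq> E" using y_E w(1) by blast
  qed (rule y_in_E u x_inc x_Suc_inc)+
qed

text \<open>The cycle closed by e runs
  u, y i, x i, ..., x (j + 1), y (i + 1), x (i + 1), w, x j, ..., x (i + 2), e, u,
  where both dotted parts run backwards along the given cycle.\<close>

lemma gap_closing:
  assumes ij: "Suc i < j" "j < i + l" and w: "w \<in> E" "w \<notin> range y"
    and u: "u \<in> inc (y i)" and x: "x (Suc j) \<in> inc (y (Suc i))" "x (Suc i) \<in> inc w" "x j \<in> inc w"
    and e: "e \<in> E" "e \<noteq> w" "e = y j \<or> e \<notin> range y" "u \<in> inc e" "x (Suc (Suc i)) \<in> inc e"
  shows "berge_hamiltonian inc (insert u (range x)) E"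
proof -
  have ij': "i < j" using ij by simp
  note S = segments_cover[OF ij' ij(2)]
  let ?A = "y ` {Suc (Suc i)..<j}" and ?B = "y ` {Suc j..<i + l}" and ?f = "y (Suc i)"
  have f: "?f \<notin> ?A" "?f \<notin> ?B"
    by (rule y_notin; use ij in simp)+
  have f': "?f \<noteq> y i" "y j \<noteq> ?f"
    using y_window_inj[of i "Suc i"] y_window_inj[of "Suc i" j] ij by simp_all
  have yj: "y j \<notin> ?A" and yi: "y i \<notin> ?A" "y i \<notin> ?B"
    by (rule y_notin; use ij in simp)+
  have AB: "?A \<inter> ?B = {}"
    using y_disjoint[of j "Suc j" "i + l" "Suc (Suc i)"] by simp
  have wy: "w \<notin> ?A" "w \<notin> ?B" "y h \<noteq> w" "w \<noteq> y h" for h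
    using w(2) by auto
  have "x (Suc i) \<notin> x ` {Suc (Suc i)..j}"
    using x_disjoint[of "Suc i" "Suc (Suc i)" j "Suc i"] ij by simp
  then have "berge_path inc (x (Suc (Suc i))) (x (Suc i))
      (insert (x (Suc i)) (x ` {Suc (Suc i)..j})) (insert w ?A)"
    by (intro berge_path.extend[OF segment[of "Suc (Suc i)" j], of w "x (Suc i)"])
      (use ij wy x in simp_all)
  moreover have "insert (x (Suc i)) (x ` {Suc (Suc i)..j}) = x ` {Suc i..j}"
    using ij by (metis Suc_leI atLeastAtMost_insertL ij' image_insert)
  ultimately have P: "berge_path inc (x (Suc (Suc i))) (x (Suc i)) (x ` {Suc i..j}) (insert w ?A)"
    by simp
  have "berge_path inc (x (Suc (Suc i))) (x i) (x ` {Suc i..j} \<union> x ` {Suc j..i + l})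
      (insert ?f (insert w ?A \<union> ?B))"
  proof (rule berge_path_join[OF segment_ends(2)[OF ij' ij(2)] P])
    show "insert w ?A \<inter> ?B = {}" using AB wy by simp
    show "?f \<notin> insert w ?A" using f wy by simp
  qed (rule f S x x_Suc_inc x_inc)+
  then have P': "berge_path inc (x (Suc (Suc i))) (x i) (range x) (insert ?f (insert w ?A \<union> ?B))"
    using S(1) by simp
  show ?thesis
  proof (rule berge_hamiltonianI[where e = e])
    show "berge_path inc (x (Suc (Suc i))) u (insert u (range x))
        (insert (y i) (insert ?f (insert w ?A \<union> ?B)))"
      by (rule berge_path.extend[OF P' x_inc u u_notin]) (use yi wy f' in auto)
    \<comment> \<open>The rerouting separates \<open>x j\<close> from \<open>x (Suc j)\<close>, so
      \<open>y j\<close> is free to serve as \<open>e\<close>.\<close>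
    have "e \<noteq> y i \<and> e \<noteq> ?f \<and> e \<notin> ?A \<and> e \<notin> ?B"
    proof (cases "e = y j")
      case True
      then show ?thesis using S(7,8) f'(2) yj by simp
    next
      case False
      then show ?thesis using e(3) by auto
    qed
    then show "e \<notin> insert (y i) (insert ?f (insert w ?A \<union> ?B))"
      using e(2) by simp
    show "insert (y i) (insert ?f (insert w ?A \<union> ?B)) \<subseteq> E"
      using w(1) y_E by blast
  qed (rule e u)+
qed

end

text \<open>Disjoint nonempty sets use at least one element of \<open>W\<close> each, so the bound
  on \<open>card W\<close> forces equality throughout.\<close>

lemma pairwise_disjoint_tight:
  assumes "finite I" "finite W" "\<And>i. i \<in> I \<Longrightarrow> S i \<subseteq> W" "\<And>i. i \<in> I \<Longrightarrow> S i \<noteq> {}"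
    and "\<And>i j. i \<in> I \<Longrightarrow> j \<in> I \<Longrightarrow> i \<noteq> j \<Longrightarrow> S i \<inter> S j = {}" and "card W \<le> card I"
  shows "(\<forall>i\<in>I. card (S i) = 1) \<and> (\<Union>i\<in>I. S i) = W \<and> card W = card I"
proof -
  have fin: "finite (S i)" if "i \<in> I" for i using assms that finite_subset by blast
  then have ge: "1 \<le> card (S i)" if "i \<in> I" for i
    using assms(4) that by (simp add: Suc_le_eq card_gt_0_iff)
  have sub: "(\<Union>i\<in>I. S i) \<subseteq> W" using assms(3) by blast
  have U: "card (\<Union>i\<in>I. S i) = (\<Sum>i\<in>I. card (S i))"
    using assms(1,5) fin by (intro card_UN_disjoint) auto
  have "(\<Sum>i\<in>I. 1) \<le> (\<Sum>i\<in>I. card (S i))" using ge by (rule sum_mono)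
  moreover have "card (\<Union>i\<in>I. S i) \<le> card W" using assms(2) sub by (rule card_mono)
  ultimately have eq: "(\<Sum>i\<in>I. 1) = (\<Sum>i\<in>I. card (S i))" "card (\<Union>i\<in>I. S i) = card W"
    "card W = card I"
    using U assms(6) by simp_all
  have "\<forall>i\<in>I. 1 = card (S i)"
    using sum_mono_inv[OF eq(1)] ge assms(1) by blast
  moreover have "(\<Union>i\<in>I. S i) = W"
    using card_subset_eq[OF assms(2) sub eq(2)] .
  ultimately show ?thesis using eq(3) by simp
qed

section \<open>The extremal configurations\<close>

definition edges_at :: "('e \<Rightarrow> 'v set) \<Rightarrow> 'e set \<Rightarrow> 'v \<Rightarrow> 'e set" where
  "edges_at inc E v = {e \<in> E. v \<in> inc e}"

text \<open>\<open>Y\<close> is the part Y0 of edges common to all vertices, and \<open>p v\<close>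
  is the private edge of \<open>v\<close>.\<close>

definition G1_shaped :: "('e \<Rightarrow> 'v set) \<Rightarrow> 'v set \<Rightarrow> 'e set \<Rightarrow> nat \<Rightarrow> bool" where
  "G1_shaped inc V E \<delta> \<longleftrightarrow>
    (\<exists>Y p. Y \<subseteq> E \<and> card Y = \<delta> - 1 \<and> card V = \<delta> \<and> bij_betw p V (E - Y) \<and>
      (\<forall>v\<in>V. edges_at inc E v = insert (p v) Y))"

text \<open>\<open>s\<close> is the identified vertex, and \<open>C\<close>, \<open>D\<close> are
  the remainders of the two parts of size \<delta>. The sides \<open>A\<close> and \<open>B\<close>
  are not ordered by size, so a new vertex may join either.\<close>

definition G2_shaped :: "('e \<Rightarrow> 'v set) \<Rightarrow> 'v set \<Rightarrow> 'e set \<Rightarrow> nat \<Rightarrow> bool" where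
  "G2_shaped inc V E \<delta> \<longleftrightarrow>
    (\<exists>A B C D s. A \<noteq> {} \<and> B \<noteq> {} \<and> A \<inter> B = {} \<and> A \<union> B = V \<and>
      C \<inter> D = {} \<and> s \<notin> C \<union> D \<and> insert s (C \<union> D) = E \<and> card C = \<delta> - 1 \<and> card D = \<delta> - 1 \<and>
      (\<forall>v\<in>A. edges_at inc E v = insert s C) \<and> (\<forall>v\<in>B. edges_at inc E v = insert s D))"

text \<open>By inclusion-exclusion the intersection has at least
  \<open>2 * \<delta> - card E > 0\<close> elements; if it has only one, every estimate is an
  equality.\<close>

lemma card_Int_ge:
  assumes "finite E" "A \<subseteq> E" "B \<subseteq> E" "\<delta> \<le> card A" "\<delta> \<le> card B" "card E < 2 * \<delta>"
  shows "A \<inter> B \<noteq> {}"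
    and "A \<inter> B = {s} \<Longrightarrow> A \<union> B = E \<and> card A = \<delta> \<and> card B = \<delta>"
proof -
  have fin: "finite A" "finite B" using assms finite_subset by blast+
  note c = card_Un_Int[OF fin] card_mono[OF assms(1), of "A \<union> B"]
  then show "A \<inter> B \<noteq> {}" using assms by auto
  show "A \<union> B = E \<and> card A = \<delta> \<and> card B = \<delta>" if "A \<inter> B = {s}"
    using that c assms card_subset_eq[OF assms(1), of "A \<union> B"] by auto
qed

text \<open>The cycle is chosen so that as few of its edges as possible contain the missing vertex u.\<close>

locale extremal_cycle = extra_vertex inc x y l u E
  for inc :: "'e \<Rightarrow> 'v set" and x y l u E +
  fixes \<delta> :: nat
  assumes finite_E: "finite E" and l_less: "l < \<delta>" and card_E: "card E < 2 * \<delta>"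
    and degree: "\<And>v. v \<in> insert u (range x) \<Longrightarrow> \<delta> \<le> card (edges_at inc E v)"
    and no_cycle: "\<not> berge_hamiltonian inc (insert u (range x)) E"
    and minimal: "\<And>y'. periodic_cycle inc x y' l \<Longrightarrow> range y' \<subseteq> E \<Longrightarrow>
      card (edges_at inc E u \<inter> range y) \<le> card (edges_at inc E u \<inter> range y')"
begin

abbreviation N where "N \<equiv> edges_at inc E"

lemma N_iff: "e \<in> N v \<longleftrightarrow> e \<in> E \<and> v \<in> inc e"
  by (simp add: edges_at_def)

lemma N_subset: "N v \<subseteq> E" and finite_N: "finite (N v)"
  using finite_E by (auto simp: edges_at_def)

lemma degree_u: "\<delta> \<le> card (N u)" and degree_x: "\<delta> \<le> card (N (x i))"
  using degree by auto

text \<open>Two different edges would insert \<open>u\<close> between \<open>x i\<close> and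
  \<open>x (Suc i)\<close>, with \<open>y i\<close> dropped.\<close>

lemma not_both_ends:
  assumes "e \<in> N u - range y" "f \<in> N u - range y" "e \<in> N (x i)" "f \<in> N (x (Suc i))"
  shows "e = f"
proof (rule ccontr)
  assume "e \<noteq> f"
  then show False
    using insert_between[of e f i] no_cycle assms by (auto simp: N_iff)
qed

text \<open>Here \<open>y i\<close> stays in use: it would join \<open>u\<close> to one of its ends
  while \<open>e\<close> joins \<open>u\<close> to the other.\<close>

lemma no_outer_common:
  assumes "u \<in> inc (y i)" "e \<in> N u - range y"
  shows "e \<notin> N (x i)" "e \<notin> N (x (Suc i))"
proof -
  have "y i \<notin> y ` {Suc i..<i + l}" by (rule y_notin) simp_all
  then show "e \<notin> N (x i)" "e \<notin> N (x (Suc i))"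
    using insert_between[of "e" "y i" i] insert_between[of "y i" e i] no_cycle assms
      x_inc x_Suc_inc y_in_E by (auto simp: N_iff)
qed

text \<open>Otherwise replacing y i by w would contradict minimality.\<close>

lemma consecutive_disjoint:
  assumes "u \<in> inc (y i)" "w \<in> N (x i)" "w \<in> N (x (Suc i))"
  shows "w \<in> range y"
proof (rule ccontr)
  assume w: "w \<notin> range y"
  then have "w \<notin> N u" using no_outer_common assms by blast
  let ?y = "\<lambda>k. if k mod l = i mod l then w else y k"
  have y': "periodic_cycle inc x ?y l"
    by (rule update_edge) (use assms w in \<open>auto simp: N_iff\<close>)
  have "range ?y \<subseteq> E" using assms y_E by (auto simp: N_iff)
  then have "card (N u \<inter> range y) \<le> card (N u \<inter> range ?y)" by (rule minimal[OF y'])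
  moreover have "y i \<notin> range ?y" using w y_eq by auto
  moreover have "range ?y \<subseteq> insert w (range y)" by auto
  ultimately have "N u \<inter> range ?y \<subset> N u \<inter> range y"
    using \<open>w \<notin> N u\<close> assms(1) y_in_E[of i] by (auto simp: N_iff)
  then have "card (N u \<inter> range ?y) < card (N u \<inter> range y)"
    by (intro psubset_card_mono) (simp_all add: finite_N)
  with \<open>card (N u \<inter> range y) \<le> card (N u \<inter> range ?y)\<close> show False by simp
qed

text \<open>A common off-cycle edge would serve as \<open>w\<close> in one of the two
  crossings.\<close>

lemma crossing_disjoint:
  assumes "u \<in> inc (y i)" "u \<in> inc (y j)" "y i \<noteq> y j"
  shows "(N (x (Suc i)) - range y) \<inter> (N (x (Suc j)) - range y) = {}"
    and "(N (x i) - range y) \<inter> (N (x j) - range y) = {}"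
proof -
  obtain k where k: "i \<le> k" "k < i + l" "k mod l = j mod l"
    using window_representative[OF l_pos] by blast
  have eq: "y k = y j" "x k = x j" "x (Suc k) = x (Suc j)"
    unfolding x_eq y_eq using k by (simp, simp, metis mod_Suc_eq)
  then have "i < k" using k assms(3) le_neq_implies_less by blast
  then show "(N (x (Suc i)) - range y) \<inter> (N (x (Suc j)) - range y) = {}"
    and "(N (x i) - range y) \<inter> (N (x j) - range y) = {}"
    using crossing_right[of i k] crossing_left[of i k] k no_cycle assms eq
    by (auto simp: N_iff)
qed

section \<open>Counting edges on and off the cycle\<close>

lemma card_outer: "card (E - range y) = card E - l"
  using card_Diff_subset[OF finite_range_y y_E] card_range_y by simp

lemma card_N_outer: "\<delta> \<le> card (N (x i) - range y) + card (N (x i) \<inter> range y)"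
  using degree_x[of i] card_Int_Diff[OF finite_N, of "x i" "range y"] by simp

lemma card_N_inner: "card (N v \<inter> range y) \<le> l"
  using card_mono[OF finite_range_y, of "N v \<inter> range y"] card_range_y by simp

text \<open>By the degree condition \<open>u\<close> shares an edge with every \<open>x i\<close>,
  and that edge is off the cycle. \<open>not_both_ends\<close> carries one such edge
  \<open>s\<close> around the cycle and excludes any other. The counts in \<open>card_Int_ge\<close>
  are then tight, and the two sides are \<open>{u}\<close> and \<open>range x\<close>.\<close>

lemma G2_shaped_if_disjoint:
  assumes "N u \<inter> range y = {}"
  shows "G2_shaped inc (insert u (range x)) E \<delta>"
proof -
  have common: "N u \<inter> N (x i) \<noteq> {}" for i
    using card_Int_ge(1)[OF finite_E N_subset N_subset degree_u degree_x card_E] .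
  have outer: "e \<in> N u - range y" if "e \<in> N u" for e using that assms by blast
  obtain s where s: "s \<in> N u" "s \<in> N (x 0)" using common[of 0] by blast
  have s_all: "s \<in> N (x i)" for i
  proof (induction i)
    case (Suc i)
    obtain e where "e \<in> N u" "e \<in> N (x (Suc i))" using common by blast
    moreover from this have "s = e"
      using not_both_ends[OF outer[OF s(1)] outer Suc] by simp
    ultimately show ?case by simp
  qed (rule s(2))
  have only_s: "N u \<inter> N (x i) = {s}" for i
  proof -
    have "e = s" if "e \<in> N u" "e \<in> N (x i)" for e
      using not_both_ends[OF outer[OF that(1)] outer[OF s(1)] that(2) s_all] .
    then show ?thesis using s(1) s_all by blast
  qed
  note tight = card_Int_ge(2)[OF finite_E N_subset N_subset degree_u degree_x card_E only_s]
  have Nx: "N (x i) = insert s (E - N u)" for i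
    using tight[of i] only_s[of i] N_subset[of u] N_subset[of "x i"] s by blast
  have "card (N u - {s}) = \<delta> - 1" using tight s by simp
  moreover have "card (E - N u) = \<delta> - 1"
    using tight[of 0] Nx[of 0] s finite_E by (auto simp: card_insert_if)
  ultimately show ?thesis
    unfolding G2_shaped_def using u_notin s N_subset[of u] Nx
    by (intro exI[of _ "{u}"] exI[of _ "range x"] exI[of _ "N u - {s}"] exI[of _ "E - N u"] exI[of _ s])
      auto
qed

lemma extremal_shape:
  "G1_shaped inc (insert u (range x)) E \<delta> \<or> G2_shaped inc (insert u (range x)) E \<delta>"
proof (cases "N u \<inter> range y = {}")
  case True
  then show ?thesis using G2_shaped_if_disjoint by blast
next
  case False
  define I where "I = {i. i < l \<and> u \<in> inc (y i)}"
  define Out where "Out v = N v - range y" for v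
  \<comment> \<open>By \<open>no_outer_common\<close>, the off-cycle edges at the ends of a cycle
    edge containing \<open>u\<close> all lie in \<open>W\<close>.\<close>
  define W where "W = E - range y - N u"
  have fin: "finite I" "finite W" "\<And>v. finite (Out v)"
    unfolding I_def W_def Out_def using finite_E finite_N by simp_all
  have rep: "i mod l \<in> I \<and> x (i mod l) = x i \<and> x (Suc (i mod l)) = x (Suc i)"
    if "u \<in> inc (y i)" for i
  proof -
    have "y (i mod l) = y i" by (simp add: y_eq)
    then show ?thesis using that l_pos unfolding I_def x_eq by (simp add: mod_Suc_eq)
  qed
  have y_inj: "y i \<noteq> y j" if "i \<in> I" "j \<in> I" "i \<noteq> j" for i j
    using that unfolding I_def y_eq by simp
  have "y ` I = N u \<inter> range y"
  proof
    show "y ` I \<subseteq> N u \<inter> range y" using y_in_E by (auto simp: I_def N_iff)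
    show "N u \<inter> range y \<subseteq> y ` I"
    proof
      fix e assume "e \<in> N u \<inter> range y"
      then obtain i where "e = y i" "u \<in> inc (y i)" by (auto simp: N_iff)
      then have "e = y (i mod l)" "i mod l \<in> I" using rep by (simp_all add: y_eq)
      then show "e \<in> y ` I" by blast
    qed
  qed
  moreover have "inj_on y I" using y_inj unfolding inj_on_def by blast
  ultimately have card_I: "card I = card (N u \<inter> range y)" and "I \<noteq> {}"
    using card_image[of y I] False by auto
  have "E - range y = W \<union> Out u" "W \<inter> Out u = {}"
    using N_subset by (auto simp: W_def Out_def)
  then have card_W_u: "card W + card (Out u) + l = card E"
    using card_outer card_Un_disjoint[OF fin(2) fin(3)] card_mono[OF finite_E y_E] card_range_y
    by simp
  have "\<delta> \<le> card (Out u) + card I"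
    using degree_u card_Int_Diff[OF finite_N, of u "range y"] card_I by (simp add: Out_def)
  \<comment> \<open>Of at most 2 * \<delta> - 1 edges, \<open>l\<close> are on the cycle and at
    least \<delta> - \<open>card I\<close> belong to \<open>Out u\<close>.\<close>
  then have W_le: "card W + l + 1 \<le> \<delta> + card I"
    using card_W_u card_E by simp
  have sub: "Out (x i) \<subseteq> W" "Out (x (Suc i)) \<subseteq> W" if "u \<in> inc (y i)" for i
    using no_outer_common[OF that] N_subset by (auto simp: W_def Out_def)
  have Out_ge: "\<delta> \<le> card (Out (x i)) + l" for i
    using card_N_outer[of i] card_N_inner[of "x i"] by (simp add: Out_def)
  then have Out_ne: "Out (x i) \<noteq> {}" for i
    using l_less by (metis add_0 card.empty not_le)
  have disj: "Out (x i) \<inter> Out (x j) = {}" "Out (x (Suc i)) \<inter> Out (x (Suc j)) = {}"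
    if "i \<in> I" "j \<in> I" "i \<noteq> j" for i j
    using crossing_disjoint[of i j] y_inj[OF that] that by (simp_all add: I_def Out_def)
  have consec: "Out (x i) \<inter> Out (x (Suc i)) = {}" if "u \<in> inc (y i)" for i
    using consecutive_disjoint[OF that] by (auto simp: Out_def)
  \<comment> \<open>Two disjoint sets of at least \<delta> - l elements would have to fit into
    \<open>W\<close>, which has at most \<delta> - l.\<close>
  have "card I \<noteq> 1"
  proof
    assume 1: "card I = 1"
    obtain i where "i \<in> I" using \<open>I \<noteq> {}\<close> by blast
    then have i: "u \<in> inc (y i)" by (simp add: I_def)
    have "card (Out (x i)) + card (Out (x (Suc i))) \<le> card W"
      using card_Un_disjoint[OF fin(3) fin(3) consec[OF i]] card_mono[OF fin(2)] sub[OF i]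
      by (metis Un_least)
    then show False using Out_ge[of i] Out_ge[of "Suc i"] W_le 1 l_less by simp
  qed
  moreover have "card I \<noteq> 0" using \<open>I \<noteq> {}\<close> fin(1) by simp
  ultimately have two: "2 \<le> card I" by simp
  \<comment> \<open>\<open>W\<close> contains \<open>card I\<close> disjoint sets of size at least
    \<delta> - l. Writing \<delta> = l + 1 + k, the bound on \<open>W\<close> gives
    \<open>card I * k \<le> k\<close>, so k = 0 because \<open>card I\<close> is at least 2.\<close>
  have \<delta>: "\<delta> = Suc l"
  proof -
    have "(\<Sum>i\<in>I. \<delta> - l) \<le> (\<Sum>i\<in>I. card (Out (x i)))"
      using Out_ge by (intro sum_mono) (simp add: le_diff_conv)
    also have "\<dots> = card (\<Union>i\<in>I. Out (x i))"
      using fin disj by (intro card_UN_disjoint[symmetric]) auto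
    also have "\<dots> \<le> card W"
      using sub by (intro card_mono fin(2)) (auto simp: I_def)
    finally have le: "card I * (\<delta> - l) + l + 1 \<le> \<delta> + card I" using W_le by simp
    obtain k where k: "\<delta> = Suc l + k" using l_less by (metis less_iff_Suc_add add_Suc)
    then have "card I * k \<le> k" using le by simp
    moreover have "2 * k \<le> card I * k" using two by simp
    ultimately show ?thesis using k by linarith
  qed
  then have W_I: "card W \<le> card I" using W_le by simp
  have left: "(\<forall>i\<in>I. card (Out (x i)) = 1) \<and> (\<Union>i\<in>I. Out (x i)) = W \<and> card W = card I"
    by (rule pairwise_disjoint_tight) (use fin sub disj W_I Out_ne in \<open>simp_all add: I_def\<close>)
  have right: "(\<forall>i\<in>I. card (Out (x (Suc i))) = 1) \<and> (\<Union>i\<in>I. Out (x (Suc i))) = W \<and> card W = card I"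
    by (rule pairwise_disjoint_tight) (use fin sub disj W_I Out_ne in \<open>simp_all add: I_def\<close>)
  have card1: "card (Out (x i)) = 1" "card (Out (x (Suc i))) = 1" if "u \<in> inc (y i)" for i
    using left right rep[OF that] by metis+
  \<comment> \<open>The vertex \<open>x i\<close> has at least l + 1 edges and only one off the
    cycle, so it lies on all \<open>l\<close> edges of the cycle.\<close>
  have full: "range y \<subseteq> N (x i)" if "card (Out (x i)) = 1" for i
  proof -
    have "card (range y) \<le> card (N (x i) \<inter> range y)"
      using card_N_outer[of i] that card_range_y \<delta> by (simp add: Out_def)
    then show ?thesis
      by (metis card_seteq finite_range_y inf_le1 inf_le2)
  qed
  show ?thesis
  proof (cases "\<forall>i. u \<in> inc (y i)")
    case True
    then have "I = {..<l}" by (auto simp: I_def)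
    then have "card I = l" by simp
    then have card_u: "card (Out u) = 1"
      using card_W_u card_E left \<delta> \<open>\<delta> \<le> card (Out u) + card I\<close> by simp
    let ?V = "insert u (range x)"
    \<comment> \<open>The only off-cycle edge of \<open>v\<close> becomes its private
      neighbor.\<close>
    define p where "p v = the_elem (Out v)" for v
    have "card (Out v) = 1" if "v \<in> ?V" for v using that card_u card1 True by auto
    then have p: "Out v = {p v}" if "v \<in> ?V" for v
      using that unfolding p_def by (metis card_1_singletonE the_elem_eq)
    have "range y \<subseteq> N v" if "v \<in> ?V" for v
      using that full card1 True y_in_E by (auto simp: N_iff)
    then have N: "N v = insert (p v) (range y)" if "v \<in> ?V" for v
      using that p[OF that] unfolding Out_def by blast
    have img: "p ` ?V = E - range y"
    proof
      show "p ` ?V \<subseteq> E - range y" using p N_subset unfolding Out_def by blast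
      have "W \<subseteq> p ` range x" using left p by auto
      moreover have "Out u \<subseteq> p ` ?V" using p by auto
      ultimately show "E - range y \<subseteq> p ` ?V" using \<open>E - range y = W \<union> Out u\<close> by auto
    qed
    have card_V: "card ?V = \<delta>" using u_notin finite_range_x card_range_x \<delta> by simp
    \<comment> \<open>As \<open>p\<close> maps onto a set of the same size as its domain, it is
      injective.\<close>
    have "card (E - range y) = \<delta>"
      using card_outer card_W_u card_u left \<open>card I = l\<close> \<delta> by simp
    then have "inj_on p ?V"
      using img card_V finite_range_x by (intro eq_card_imp_inj_on) simp_all
    then have bij: "bij_betw p ?V (E - range y)"
      using img by (simp add: bij_betw_def)
    have "card (range y) = \<delta> - 1" using card_range_y \<delta> by simp
    then have "G1_shaped inc ?V E \<delta>"
      unfolding G1_shaped_def using y_E card_V bij N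
      by (intro exI[of _ "range y"] exI[of _ p]) simp
    then show ?thesis ..
  next
    case False
    then obtain k where k: "u \<notin> inc (y k)" by blast
    obtain i0 where i0: "u \<in> inc (y i0)" using \<open>I \<noteq> {}\<close> by (auto simp: I_def)
    \<comment> \<open>Otherwise membership of \<open>u\<close> would pass from each cycle edge to
      the next, all the way around to \<open>y k\<close>.\<close>
    have "\<exists>i. u \<in> inc (y i) \<and> u \<notin> inc (y (Suc i))"
    proof (rule ccontr)
      assume "\<nexists>i. u \<in> inc (y i) \<and> u \<notin> inc (y (Suc i))"
      then have "u \<in> inc (y (i0 + h))" for h using i0 by (induction h) auto
      moreover obtain h where "i0 \<le> h" "h mod l = k mod l"
        using window_representative[OF l_pos] by blast
      ultimately show False using k y_eq by (metis le_add_diff_inverse)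
    qed
    then obtain i where i: "u \<in> inc (y i)" "u \<notin> inc (y (Suc i))" by blast
    obtain w where w: "w \<in> Out (x (Suc i))" using Out_ne by blast
    then have "w \<in> W" using sub i by blast
    \<comment> \<open>The sets \<open>Out (x j0)\<close> cover \<open>W\<close>, so \<open>w\<close>
      contains a further cycle vertex; its index is then moved into the window starting at
      \<open>i\<close>.\<close>
    then obtain j0 where j0: "j0 \<in> I" "w \<in> Out (x j0)" using left by blast
    obtain j where j: "i \<le> j" "j < i + l" "j mod l = j0 mod l"
      using window_representative[OF l_pos] by blast
    then have "y j = y j0" "x j = x j0" by (simp_all add: x_eq y_eq)
    then have uj: "u \<in> inc (y j)" and wj: "w \<in> Out (x j)" using j0 by (simp_all add: I_def)
    have "j \<noteq> i" using consec[OF i(1)] w wj by blast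
    moreover have "j \<noteq> Suc i" using i uj by blast
    ultimately have ij: "Suc i < j" using j by simp
    have w': "w \<in> E" "w \<notin> range y" "w \<notin> N u" using \<open>w \<in> W\<close> by (auto simp: W_def)
    have wx: "x (Suc i) \<in> inc w" "x j \<in> inc w" using w wj by (simp_all add: Out_def N_iff)
    have all_y: "x h \<in> inc (y q)" "x (Suc h) \<in> inc (y q)" if "u \<in> inc (y h)" for h q
      using full[OF card1(1)[OF that]] full[OF card1(2)[OF that]] unfolding edges_at_def by blast+
    \<comment> \<open>This edge between \<open>x (i + 2)\<close> and \<open>u\<close> is to close
      the cycle in \<open>gap_closing\<close>; it differs from \<open>w\<close> because
      \<open>w\<close> misses \<open>u\<close>.\<close>
    obtain e where e: "e \<in> N u" "e \<in> N (x (Suc (Suc i)))"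
      using card_Int_ge(1)[OF finite_E N_subset N_subset degree_u degree_x card_E] by blast
    then have e': "e \<in> E" "u \<in> inc e" "x (Suc (Suc i)) \<in> inc e" "e \<noteq> w"
      using w' by (auto simp: N_iff)
    have False
    proof (cases "e \<in> range y")
      case False
      then show False
        using gap_closing[OF ij j(2) w'(1,2) i(1) all_y(2)[OF uj] wx e'(1,4) _ e'(2,3)] no_cycle
        by simp
    next
      case True
      then obtain q where q: "e = y q" by blast
      \<comment> \<open>The ends of y q and of y j lie on every edge of the cycle, so the two edges may trade places.\<close>
      let ?y = "\<lambda>k. if k mod l = q mod l then y j else if k mod l = j mod l then y q else y k"
      have uq: "u \<in> inc (y q)" using q e' by simp
      have cyc: "periodic_cycle inc x ?y l"
        by (rule swap_edges) (use all_y uq uj in blast)+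
      have sub_y: "range ?y \<subseteq> range y" by auto
      \<comment> \<open>The trade leaves \<open>y (Suc i)\<close> in place, since it misses
        \<open>u\<close> while both traded edges contain \<open>u\<close>. For the same reason
        position \<open>i\<close> still holds an edge containing \<open>u\<close>.\<close>
      have neq: "Suc i mod l \<noteq> q mod l" "Suc i mod l \<noteq> j mod l"
        using i(2) uq uj y_eq[of "Suc i"] by metis+
      have "range ?y \<subseteq> E" using sub_y y_E by (rule subset_trans)
      then interpret swapped: extra_vertex inc x ?y l u E
        by (rule extra_vertex.intro[OF cyc extra_vertex_axioms.intro[OF u_notin]])
      have "u \<in> inc (?y i)" using i uq uj by simp
      moreover have "x (Suc j) \<in> inc (?y (Suc i))" using neq all_y(2)[OF uj] by simp
      moreover have "e = ?y j" using q by (simp add: y_eq)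
      moreover have "w \<notin> range ?y" using sub_y w'(2) by (rule contra_subsetD)
      ultimately show False
        using swapped.gap_closing[OF ij j(2) w'(1) _ _ _ wx e'(1,4) _ e'(2,3)] no_cycle by simp
    qed
    then show ?thesis ..
  qed
qed

end

section \<open>Induction on the vertex set\<close>

text \<open>The configuration is symmetric under exchanging \<open>A\<close>, \<open>C\<close> with
  \<open>B\<close>, \<open>D\<close>, so the larger side can be put first, as the condition a \<ge>
  b demands.\<close>

lemma G2_shapedE:
  assumes "G2_shaped inc V E \<delta>"
  obtains A B C D s where "A \<noteq> {}" "B \<noteq> {}" "A \<inter> B = {}" "A \<union> B = V"
    "C \<inter> D = {}" "s \<notin> C \<union> D" "insert s (C \<union> D) = E" "card C = \<delta> - 1" "card D = \<delta> - 1"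
    "\<forall>v\<in>A. edges_at inc E v = insert s C" "\<forall>v\<in>B. edges_at inc E v = insert s D"
    "card B \<le> card A"
proof -
  obtain A B C D s where *: "A \<noteq> {}" "B \<noteq> {}" "A \<inter> B = {}" "A \<union> B = V"
    "C \<inter> D = {}" "s \<notin> C \<union> D" "insert s (C \<union> D) = E" "card C = \<delta> - 1" "card D = \<delta> - 1"
    "\<forall>v\<in>A. edges_at inc E v = insert s C" "\<forall>v\<in>B. edges_at inc E v = insert s D"
    using assms unfolding G2_shaped_def by (elim exE conjE)
  show thesis
  proof (cases "card B \<le> card A")
    case True
    show thesis by (rule that[OF * True])
  next
    case False
    then have le: "card A \<le> card B" by simp
    show thesis
    proof (rule that[OF *(2,1)])
      show "B \<inter> A = {}" "B \<union> A = V" "D \<inter> C = {}" "s \<notin> D \<union> C" "insert s (D \<union> C) = E"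
        using *(3-7) by blast+
    qed (rule * le)+
  qed
qed

text \<open>If \<open>u\<close> lay on some \<open>c\<close> in \<open>C\<close> and some
  \<open>d\<close> in \<open>D\<close>, a cycle could run through \<open>A\<close>, cross by
  \<open>s\<close>, run through \<open>B\<close> and return by \<open>d\<close>, \<open>u\<close>,
  \<open>c\<close>. Hence all edges at \<open>u\<close> belong to one side, and \<open>u\<close>
  joins it.\<close>

lemma extend_G2_shaped:
  assumes "finite E" "finite V" "u \<notin> V" "card V + 1 \<le> \<delta>" "G2_shaped inc V E \<delta>"
    and deg: "\<delta> \<le> card (edges_at inc E u)" and no: "\<not> berge_hamiltonian inc (insert u V) E"
  shows "G2_shaped inc (insert u V) E \<delta>"
proof -
  let ?N = "edges_at inc E"
  obtain A B C D s where AB: "A \<noteq> {}" "B \<noteq> {}" "A \<inter> B = {}" "A \<union> B = V"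
    and CD: "C \<inter> D = {}" "s \<notin> C \<union> D" "insert s (C \<union> D) = E" "card C = \<delta> - 1" "card D = \<delta> - 1"
    and N: "\<forall>v\<in>A. ?N v = insert s C" "\<forall>v\<in>B. ?N v = insert s D"
    using assms(5) by (rule G2_shapedE)
  have fin: "finite A" "finite B" "finite C" "finite D"
    using AB(4) CD(3) assms(1,2) by (metis finite_Un, metis finite_Un, metis finite_Un finite_insert, metis finite_Un finite_insert)
  have card_V: "card A + card B = card V"
    using card_Un_disjoint[OF fin(1,2) AB(3)] AB(4) by simp
  have pos: "0 < card A" "0 < card B" using fin AB by (simp_all add: card_gt_0_iff)
  have incA: "A \<subseteq> inc c" if "c \<in> insert s C" for c
    using that N(1) unfolding edges_at_def by blast
  have incB: "B \<subseteq> inc c" if "c \<in> insert s D" for c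
    using that N(2) unfolding edges_at_def by blast
  have Nu: "?N u \<subseteq> insert s (C \<union> D)" using CD(3) unfolding edges_at_def by blast
  have "\<not> (c \<in> C \<and> d \<in> D)" if cd: "c \<in> ?N u" "d \<in> ?N u" for c d
  proof
    assume "c \<in> C \<and> d \<in> D"
    then have c: "c \<in> C" and d: "d \<in> D" by simp_all
    \<comment> \<open>The edges \<open>c\<close> and \<open>d\<close> are reserved for
      \<open>u\<close>; enough others remain because both sides are nonempty and
      \<open>card V < \<delta>\<close>.\<close>
    have "card A \<le> Suc (card (C - {c}))" "card B \<le> Suc (card (D - {d}))"
      using c d fin CD(4,5) card_V pos assms(4) by simp_all
    moreover have "A \<subseteq> inc c'" if "c' \<in> C - {c}" for c' using that incA by simp
    moreover have "B \<subseteq> inc d'" if "d' \<in> D - {d}" for d' using that incB by simp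
    ultimately obtain a a' F b b' G where P: "F \<subseteq> C - {c}" "berge_path inc a a' A F"
      and Q: "G \<subseteq> D - {d}" "berge_path inc b b' B G"
      using berge_path_complete[OF fin(1) AB(1) finite_Diff[OF fin(3)], of "{c}"]
        berge_path_complete[OF fin(2) AB(2) finite_Diff[OF fin(4)], of "{d}"] by meson
    note ends = berge_path_ends[OF P(2)] berge_path_ends[OF Q(2)]
    have R: "berge_path inc a b' (A \<union> B) (insert s (F \<union> G))"
    proof (rule berge_path_join[OF Q(2) P(2)])
      show "a' \<in> inc s" "b \<in> inc s" using ends incA incB by blast+
      show "F \<inter> G = {}" "s \<notin> F" "s \<notin> G" using P(1) Q(1) CD(1,2) by blast+
    qed (rule AB)
    have "berge_hamiltonian inc (insert u (A \<union> B)) E"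
    proof (rule berge_hamiltonianI[where e = c])
      show "berge_path inc a u (insert u (A \<union> B)) (insert d (insert s (F \<union> G)))"
      proof (rule berge_path.extend[OF R])
        show "b' \<in> inc d" using ends incB d by blast
        show "u \<in> inc d" using cd unfolding edges_at_def by blast
        show "u \<notin> A \<union> B" using AB assms(3) by blast
        show "d \<notin> insert s (F \<union> G)" using P(1) Q(1) CD d by blast
      qed
      show "insert d (insert s (F \<union> G)) \<subseteq> E" using P(1) Q(1) CD(3) d by blast
      show "c \<notin> insert d (insert s (F \<union> G))" using P(1) Q(1) CD(1,2) c d by blast
      show "c \<in> E" "u \<in> inc c" using cd unfolding edges_at_def by blast+
      show "a \<in> inc c" using ends incA c by blast
    qed
    then show False using no AB(4) by simp
  qed
  then consider "?N u \<subseteq> insert s C" | "?N u \<subseteq> insert s D" using Nu by blast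
  then show ?thesis
  proof cases
    case 1
    \<comment> \<open>\<open>insert s C\<close> has exactly \<delta> elements, so the degree of
      \<open>u\<close> rules out a proper subset.\<close>
    have "card (insert s C) \<le> card (?N u)"
      using deg CD fin card_V pos assms(4) by (simp add: card_insert_if)
    then have "?N u = insert s C" using card_seteq[of "insert s C"] 1 fin by simp
    moreover have "insert u A \<noteq> {}" "insert u A \<inter> B = {}" "insert u A \<union> B = insert u V"
      using AB assms(3) by auto
    ultimately show ?thesis unfolding G2_shaped_def
      using AB CD N
      by (intro exI[of _ "insert u A"] exI[of _ "B"] exI[of _ C] exI[of _ D] exI[of _ s]) simp
  next
    case 2
    have "card (insert s D) \<le> card (?N u)"
      using deg CD fin card_V pos assms(4) by (simp add: card_insert_if)
    then have "?N u = insert s D" using card_seteq[of "insert s D"] 2 fin by simp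
    moreover have "insert u B \<noteq> {}" "A \<inter> insert u B = {}" "A \<union> insert u B = insert u V"
      using AB assms(3) by auto
    ultimately show ?thesis unfolding G2_shaped_def
      using AB CD N
      by (intro exI[of _ "A"] exI[of _ "insert u B"] exI[of _ C] exI[of _ D] exI[of _ s]) simp
  qed
qed

lemma extend_berge_hamiltonian:
  assumes "finite E" "finite V" "u \<notin> V" "card V + 1 \<le> \<delta>" "card E < 2 * \<delta>"
    and deg: "\<And>v. v \<in> insert u V \<Longrightarrow> \<delta> \<le> card (edges_at inc E v)"
    and ham: "berge_hamiltonian inc V E" and no: "\<not> berge_hamiltonian inc (insert u V) E"
  shows "G1_shaped inc (insert u V) E \<delta> \<or> G2_shaped inc (insert u V) E \<delta>"
proof -
  obtain x y0 where x: "periodic_cycle inc x y0 (card V)" "range x = V" "range y0 \<subseteq> E"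
    using hamiltonian_periodic_cycle[OF ham] by blast
  define P where "P y \<longleftrightarrow> periodic_cycle inc x y (card V) \<and> range y \<subseteq> E" for y
  \<comment> \<open>The vertex order \<open>x\<close> stays fixed; the minimum is taken over the
    edge sequences that fit it.\<close>
  obtain y where y: "P y"
    "\<And>y'. P y' \<Longrightarrow> card (edges_at inc E u \<inter> range y) \<le> card (edges_at inc E u \<inter> range y')"
    using x ex_has_least_nat[of P y0 "\<lambda>y. card (edges_at inc E u \<inter> range y)"]
    unfolding P_def by blast
  interpret periodic_cycle inc x y "card V" using y(1) unfolding P_def by blast
  interpret extremal_cycle inc x y "card V" u E \<delta>
    by unfold_locales (use assms x y in \<open>auto simp: P_def\<close>)
  show ?thesis using extremal_shape x(2) by simp
qed

text \<open>Only the vertex set shrinks in the induction: \<open>E\<close> and \<open>inc\<close>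
  stay, so the remaining vertices keep their degrees, and edges may contain vertices outside
  \<open>V\<close>.\<close>

lemma berge_hamiltonian_or_extremal:
  assumes "finite V" "V \<noteq> {}" "finite E" "card V \<le> \<delta>" "card E < 2 * \<delta>"
    and "\<And>v. v \<in> V \<Longrightarrow> \<delta> \<le> card (edges_at inc E v)"
    and "\<not> berge_hamiltonian inc V E"
  shows "G1_shaped inc V E \<delta> \<or> G2_shaped inc V E \<delta>"
  using assms
proof (induction V rule: finite_ne_induct)
  case (singleton v)
  \<comment> \<open>As \<delta> is at least 1, some edge contains \<open>v\<close> and closes a
    cycle of length one.\<close>
  have "edges_at inc E v \<noteq> {}"
    using singleton.prems(2,3) singleton.prems(4)[of v] by auto
  then obtain e where "e \<in> E" "v \<in> inc e" unfolding edges_at_def by blast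
  then have "berge_hamiltonian inc {v} E"
    using berge_hamiltonianI[OF berge_path.single] by fast
  then show ?case using singleton.prems by blast
next
  case (insert u V)
  then have card: "card V + 1 \<le> \<delta>" by simp
  show ?case
  proof (cases "berge_hamiltonian inc V E")
    case True
    then show ?thesis
      using extend_berge_hamiltonian[OF insert.prems(1) insert.hyps(1,3) card insert.prems(3,4) _ insert.prems(5)]
      by blast
  next
    case False
    then have "G1_shaped inc V E \<delta> \<or> G2_shaped inc V E \<delta>"
      using insert.IH insert.prems card by simp
    \<comment> \<open>A G1 configuration has exactly \<delta> vertices, but \<open>V\<close> has
      fewer.\<close>
    moreover have "\<not> G1_shaped inc V E \<delta>" using card unfolding G1_shaped_def by auto
    ultimately show ?thesis
      using extend_G2_shaped[OF insert.prems(1) insert.hyps(1,3) card _ _ insert.prems(5)] insert.prems(4)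
      by blast
  qed
qed

section \<open>Isomorphism with the extremal graphs\<close>

lemma bij_betw_lessThan:
  assumes "finite A" "card A = n"
  obtains h where "bij_betw h A {..<n}"
  using ex_bij_betw_finite_nat[OF assms(1)] assms(2) by (auto simp: atLeast0LessThan)

lemma graph_iso_G1:
  assumes "G1_shaped inc V E \<delta>" "finite V" "finite E"
  shows "graph_iso (inc_verts V E) (inc_adj inc) (G1_verts \<delta>) G1_adj"
proof -
  obtain Y p where Y: "Y \<subseteq> E" "card Y = \<delta> - 1" "card V = \<delta>" and p: "bij_betw p V (E - Y)"
    and N: "\<forall>v\<in>V. edges_at inc E v = insert (p v) Y"
    using assms(1) unfolding G1_shaped_def by blast
  obtain h where h: "bij_betw h V {..<\<delta>}" using bij_betw_lessThan[OF assms(2) Y(3)] .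
  obtain g where g: "bij_betw g Y {..<\<delta> - 1}"
    using bij_betw_lessThan[OF finite_subset[OF Y(1) assms(3)] Y(2)] .
  \<comment> \<open>A private edge gets the number of its owner, as adjacency in G1 compares these
    numbers.\<close>
  define q where "q = h \<circ> inv_into V p"
  have q: "bij_betw q (E - Y) {..<\<delta>}"
    unfolding q_def by (rule bij_betw_trans[OF bij_betw_inv_into[OF p] h])
  have qp: "q (p v) = h v" if "v \<in> V" for v
    using that p unfolding q_def by (simp add: bij_betw_def)
  define f where "f z = (case z of Inl v \<Rightarrow> (0::nat, h v) | Inr e \<Rightarrow> if e \<in> Y then (1, g e) else (2, q e))"
    for z :: "'b + 'a"
  have f_simps: "f (Inl v) = (0, h v)" "f (Inr e) = (if e \<in> Y then (1, g e) else (2, q e))" for v e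
    by (simp_all add: f_def)
  have inj: "inj_on f (inc_verts V E)"
  proof (rule inj_onI)
    fix a b assume "a \<in> inc_verts V E" "b \<in> inc_verts V E" "f a = f b"
    then show "a = b"
      by (cases a; cases b)
        (auto simp: inc_verts_def f_simps inj_on_eq_iff[OF bij_betw_imp_inj_on[OF h]]
          inj_on_eq_iff[OF bij_betw_imp_inj_on[OF g]] inj_on_eq_iff[OF bij_betw_imp_inj_on[OF q]]
          split: if_splits)
  qed
  have img: "f ` inc_verts V E = G1_verts \<delta>"
  proof -
    have "inc_verts V E = Inl ` V \<union> Inr ` Y \<union> Inr ` (E - Y)"
      using Y(1) by (auto simp: inc_verts_def)
    moreover have "f ` Inl ` V = Pair 0 ` h ` V" by (simp add: image_image f_simps)
    moreover have "f ` Inr ` Y = Pair 1 ` g ` Y" by (simp add: image_image f_simps)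
    moreover have "f ` Inr ` (E - Y) = Pair 2 ` q ` (E - Y)"
      by (simp add: image_image f_simps)
    ultimately have "f ` inc_verts V E = Pair 0 ` {..<\<delta>} \<union> Pair 1 ` {..<\<delta> - 1} \<union> Pair 2 ` {..<\<delta>}"
      using h g q by (simp add: image_Un bij_betw_def)
    then show ?thesis by (auto simp: G1_verts_def)
  qed
  have adj: "v \<in> inc e \<longleftrightarrow> e \<in> Y \<or> q e = h v" if "v \<in> V" "e \<in> E" for v e
  proof (cases "e \<in> Y")
    case True
    then show ?thesis using N that by (auto simp: edges_at_def)
  next
    case False
    then have "v \<in> inc e \<longleftrightarrow> e = p v" using N that unfolding edges_at_def by blast
    also have "\<dots> \<longleftrightarrow> q e = q (p v)"
      using q False that bij_betwE[OF p] by (metis Diff_iff bij_betw_imp_inj_on inj_on_eq_iff)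
    finally show ?thesis using qp False that by simp
  qed
  show ?thesis
    unfolding graph_iso_def
  proof (intro exI conjI ballI)
    show "bij_betw f (inc_verts V E) (G1_verts \<delta>)" using inj img by (simp add: bij_betw_def)
    fix a b assume "a \<in> inc_verts V E" "b \<in> inc_verts V E"
    then show "inc_adj inc a b = G1_adj (f a) (f b)"
      by (cases a; cases b) (auto simp: inc_verts_def f_simps G1_adj_def G1_adj0_def adj)
  qed
qed

lemma graph_iso_G2:
  assumes "finite V" "finite E" "A \<inter> B = {}" "A \<union> B = V"
    and "C \<inter> D = {}" "s \<notin> C \<union> D" "insert s (C \<union> D) = E" "card C = \<delta> - 1" "card D = \<delta> - 1"
    and N: "\<forall>v\<in>A. edges_at inc E v = insert s C" "\<forall>v\<in>B. edges_at inc E v = insert s D"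
  shows "graph_iso (inc_verts V E) (inc_adj inc) (G2_verts \<delta> (card A) (card B)) G2_adj"
proof -
  have fin: "finite A" "finite B" "finite C" "finite D"
    using assms(1,2,4,7) by (metis finite_Un, metis finite_Un, metis finite_Un finite_insert, metis finite_Un finite_insert)
  obtain ha where ha: "bij_betw ha A {..<card A}" using bij_betw_lessThan[OF fin(1) refl] .
  obtain hb where hb: "bij_betw hb B {..<card B}" using bij_betw_lessThan[OF fin(2) refl] .
  obtain gc where gc: "bij_betw gc C {..<\<delta> - 1}" using bij_betw_lessThan[OF fin(3) assms(8)] .
  obtain gd where gd: "bij_betw gd D {..<\<delta> - 1}" using bij_betw_lessThan[OF fin(4) assms(9)] .
  \<comment> \<open>On \<open>inc_verts V E\<close> the last branch for vertices is reached exactly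
    on \<open>B\<close>, and the last branch for edges only at \<open>s\<close>.\<close>
  define f where "f z = (case z of Inl v \<Rightarrow> if v \<in> A then (0::nat, ha v) else (1, hb v)
      | Inr e \<Rightarrow> if e \<in> C then (2, gc e) else if e \<in> D then (3, gd e) else (4, 0))"
    for z :: "'a + 'b"
  have f_simps: "f (Inl v) = (if v \<in> A then (0, ha v) else (1, hb v))"
    "f (Inr e) = (if e \<in> C then (2, gc e) else if e \<in> D then (3, gd e) else (4, 0))" for v e
    by (simp_all add: f_def)
  have verts: "inc_verts V E = Inl ` A \<union> Inl ` B \<union> Inr ` C \<union> Inr ` D \<union> {Inr s}"
    using assms(4,7) by (auto simp: inc_verts_def)
  have inj: "inj_on f (inc_verts V E)"
  proof (rule inj_onI)
    note eq = inj_on_eq_iff[OF bij_betw_imp_inj_on[OF ha]] inj_on_eq_iff[OF bij_betw_imp_inj_on[OF hb]]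
      inj_on_eq_iff[OF bij_betw_imp_inj_on[OF gc]] inj_on_eq_iff[OF bij_betw_imp_inj_on[OF gd]]
    have V: "v \<in> B" if "v \<in> V" "v \<notin> A" for v using that assms(4) by blast
    have E: "e = s" if "e \<in> E" "e \<notin> C" "e \<notin> D" for e using that assms(7) by blast
    fix a b assume "a \<in> inc_verts V E" "b \<in> inc_verts V E" "f a = f b"
    then show "a = b"
      by (cases a; cases b) (auto simp: inc_verts_def f_simps eq V dest: E split: if_splits)
  qed
  have img: "f ` inc_verts V E = G2_verts \<delta> (card A) (card B)"
  proof -
    have "f ` Inl ` A = Pair 0 ` ha ` A" by (simp add: image_image f_simps)
    moreover have "f ` Inl ` B = Pair 1 ` hb ` B"
      unfolding image_image using assms(3) by (intro image_cong) (auto simp: f_simps)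
    moreover have "f ` Inr ` C = Pair 2 ` gc ` C" by (simp add: image_image f_simps)
    moreover have "f ` Inr ` D = Pair 3 ` gd ` D"
      unfolding image_image using assms(5) by (intro image_cong) (auto simp: f_simps)
    moreover have "f (Inr s) = (4, 0)" using assms(6) by (simp add: f_simps)
    ultimately have "f ` inc_verts V E = Pair 0 ` {..<card A} \<union> Pair 1 ` {..<card B} \<union>
        Pair 2 ` {..<\<delta> - 1} \<union> Pair 3 ` {..<\<delta> - 1} \<union> {(4, 0)}"
      unfolding verts using ha hb gc gd by (simp add: image_Un bij_betw_def)
    moreover have "{(k, i) |i. i < N} = Pair k ` {..<N}" for k N :: nat by auto
    ultimately show ?thesis unfolding G2_verts_def by simp
  qed
  have adj: "v \<in> inc e \<longleftrightarrow> e = s \<or> (if v \<in> A then e \<in> C else e \<in> D)" if "v \<in> V" "e \<in> E" for v e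
    using that N assms(4) unfolding edges_at_def by auto
  show ?thesis
    unfolding graph_iso_def
  proof (intro exI conjI ballI)
    show "bij_betw f (inc_verts V E) (G2_verts \<delta> (card A) (card B))"
      using inj img by (simp add: bij_betw_def)
    have vert_edge: "v \<in> inc e \<longleftrightarrow> G2_adj0 (f (Inl v)) (f (Inr e))"
      "\<not> G2_adj0 (f (Inr e)) (f (Inl v))" if "v \<in> V" "e \<in> E" for v e
      using adj[OF that] that assms(5-7) by (auto simp: f_simps G2_adj0_def)
    have no_vert_vert: "\<not> G2_adj0 (f (Inl v)) (f (Inl w))"
      and no_edge_edge: "\<not> G2_adj0 (f (Inr e)) (f (Inr d))" for v w e d
      by (simp_all add: f_simps G2_adj0_def)
    fix a b assume "a \<in> inc_verts V E" "b \<in> inc_verts V E"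
    then show "inc_adj inc a b = G2_adj (f a) (f b)"
      by (cases a; cases b)
        (simp_all add: image_iff inc_verts_def G2_adj_def vert_edge no_vert_vert no_edge_edge)
  qed
qed

theorem theorem5:
  fixes V :: "'v set" and E :: "'e set" and inc :: "'e \<Rightarrow> 'v set"
    and n m \<delta> :: nat
  assumes "hypergraph V E inc"
    and "card V = n" and "card E = m"
    and "\<delta> \<ge> n" and "2 * \<delta> \<ge> m + 1"
    and "\<forall>v\<in>V. hdegree E inc v \<ge> \<delta>"
    and "\<not> (\<exists>vs es. hamiltonian_berge_cycle V E inc vs es)"
  shows "(\<delta> = n \<and> graph_iso (inc_verts V E) (inc_adj inc) (G1_verts n) G1_adj)
    \<or> (\<exists>a b. 0 < b \<and> b \<le> a \<and> a + b = n \<and>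
          graph_iso (inc_verts V E) (inc_adj inc) (G2_verts \<delta> a b) G2_adj)"
proof -
  have fin: "finite V" "finite E" using assms(1) unfolding hypergraph_def by blast+
  \<comment> \<open>The list encoding counts the empty cycle as hamiltonian for an empty vertex set,
    so \<open>V\<close> cannot be empty.\<close>
  have "hamiltonian_berge_cycle {} E inc [] []"
    by (simp add: hamiltonian_berge_cycle_def berge_cycle_def)
  then have "V \<noteq> {}" using assms(7) by blast
  moreover have "\<not> berge_hamiltonian inc V E" using berge_hamiltonian_cycle assms(7) by blast
  ultimately have "G1_shaped inc V E \<delta> \<or> G2_shaped inc V E \<delta>"
    using fin assms by (intro berge_hamiltonian_or_extremal) (auto simp: hdegree_def edges_at_def)
  then show ?thesis
  proof
    assume G1: "G1_shaped inc V E \<delta>"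
    then have "\<delta> = n" using assms(2) unfolding G1_shaped_def by blast
    then show ?thesis using graph_iso_G1[OF G1 fin] by simp
  next
    assume "G2_shaped inc V E \<delta>"
    then obtain A B C D s where *: "A \<noteq> {}" "B \<noteq> {}" "A \<inter> B = {}" "A \<union> B = V"
      "C \<inter> D = {}" "s \<notin> C \<union> D" "insert s (C \<union> D) = E" "card C = \<delta> - 1" "card D = \<delta> - 1"
      "\<forall>v\<in>A. edges_at inc E v = insert s C" "\<forall>v\<in>B. edges_at inc E v = insert s D"
      "card B \<le> card A"
      by (rule G2_shapedE)
    have "finite A" "finite B" using * fin by (metis finite_Un)+
    then have "0 < card B" "card A + card B = n"
      using * card_Un_disjoint[of A B] assms(2) by (simp_all add: card_gt_0_iff)
    moreover have "graph_iso (inc_verts V E) (inc_adj inc) (G2_verts \<delta> (card A) (card B)) G2_adj"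
      by (rule graph_iso_G2[OF fin *(3-11)])
    ultimately show ?thesis using *(12) by blast
  qed
qed

end
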